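(* Let $n\ge 2$, let $\Omega\subset\mathbb{R}^n$ be a bounded connected domain with smooth boundary $\Gamma$, let $R>0$ be the radius of a ball containing $\Omega$, and put $C_\Omega=\frac{R^2}{2n}$. Let $f:\overline{\Omega}\times\mathbb{R}^3\to\mathbb{R}$ be continuous. For $M\ge 0$ put $$\mathcal{D}_M=\{(x,u,v,w)\mid x\in\Omega,\ |u|\le C_\Omega^3M,\ |v|\le C_\Omega^2M,\ |w|\le C_\Omega M\}.$$ Assume that there exist numbers $M,L_1,L_2,L_3\ge 0$ such that (i) $|f(x,u,v,w)|\le M$ for all $(x,u,v,w)\in\mathcal{D}_M$; (ii) $|f(x,u_2,v_2,w_2)-f(x,u_1,v_1,w_1)|\le L_1|u_2-u_1|+L_2|v_2-v_1|+L_3|w_2-w_1|$ for all $(x,u_i,v_i,w_i)\in\mathcal{D}_M$, $i=1,2$; (iii) $q:=(C_\Omega^2L_1+C_\Omega L_2+L_3)\,C_\Omega<1$. Let $u$ be the unique solution of $$\Delta^3u=f(x,u,\Delta u,\Delta^2u)\ \text{ in }\Omega,\qquad u=\Delta u=\Delta^2u=0\ \text{ on }\Gamma$$ satisfying $\|u\|\le C_\Omega^3M$, $\|\Delta u\|\le C_\Omega^2M$, $\|\Delta^2u\|\le C_\Omega M$. Let $\varphi_0\in C(\overline\Omega)$ with $\|\varphi_0\|\le M$ (for example $\varphi_0(x)=f(x,0,0,0)$), and for $k=0,1,2,\dots$ let $w_k,v_k,u_k$ be the solutions of $$\Delta w_k=\varphi_k,\quad \Delta v_k=w_k,\quad \Delta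 u_k=v_k\ \text{ in }\Omega,\qquad w_k=v_k=u_k=0\ \text{ on }\Gamma,$$ and set $\varphi_{k+1}(x)=f(x,u_k(x),v_k(x),w_k(x))$. Then the iterative method converges geometrically, with the error estimate $$\|u_k-u\|\le\frac{C_\Omega^3q^k}{1-q}\,\|\varphi_1-\varphi_0\|,\qquad k=0,1,2,\dots$$
   Context: $\|y\|=\max_{x\in\overline\Omega}|y(x)|$ for $y\in C(\overline\Omega)$. A solution of the nonlinear boundary value problem is a function $u\in C(\overline\Omega)$ for which there are $v,w\in C(\overline\Omega)$ (written $v=\Delta u$, $w=\Delta^2u$) with $u=v=w=0$ on $\Gamma$ and $\Delta u=v$, $\Delta v=w$, $\Delta w=f(\cdot,u,v,w)$ in $\Omega$. All Laplacians (also in the problems for $w_k,v_k,u_k$) are taken in the sense of distributions, and $w_k,v_k,u_k\in C(\overline\Omega)$. Under (i)-(iii) there is exactly one solution $u$ satisfying the three stated bounds. *)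

theory Defs
  imports "HOL-Analysis.Analysis"
begin

definition partial_deriv :: "'a::euclidean_space \<Rightarrow> ('a \<Rightarrow> real) \<Rightarrow> 'a \<Rightarrow> real" where
  "partial_deriv b g x = frechet_derivative g (at x) b"

(* Meaningful for open S only. *)
fun C_k_on :: "nat \<Rightarrow> 'a::euclidean_space set \<Rightarrow> ('a \<Rightarrow> real) \<Rightarrow> bool" where
  "C_k_on 0 S g \<longleftrightarrow> continuous_on S g"
| "C_k_on (Suc k) S g \<longleftrightarrow>
     (\<forall>x\<in>S. g differentiable (at x)) \<and> (\<forall>b\<in>Basis. C_k_on k S (partial_deriv b g))"

definition smooth_on :: "'a::euclidean_space set \<Rightarrow> ('a \<Rightarrow> real) \<Rightarrow> bool" where
  "smooth_on S g \<longleftrightarrow> (\<forall>k. C_k_on k S g)"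

(* Local defining functions: near each boundary point the set is a strict sublevel set
   of a smooth function with nonvanishing gradient, so it lies locally on one side of its
   boundary, which is there the zero set of that function. *)
definition smooth_boundary :: "'a::euclidean_space set \<Rightarrow> bool" where
  "smooth_boundary \<Omega> \<longleftrightarrow>
     (\<forall>p\<in>frontier \<Omega>. \<exists>U \<rho>. open U \<and> p \<in> U \<and> smooth_on U \<rho> \<and>
        (\<forall>x\<in>U. \<exists>b\<in>Basis. partial_deriv b \<rho> x \<noteq> 0) \<and>
        \<Omega> \<inter> U = {x\<in>U. \<rho> x < 0})"

definition test_function :: "'a::euclidean_space set \<Rightarrow> ('a \<Rightarrow> real) \<Rightarrow> bool" where
  "test_function \<Omega> \<psi> \<longleftrightarrow> smooth_on UNIV \<psi> \<and>
     compact (closure {x. \<psi> x \<noteq> 0}) \<and> closure {x. \<psi> x \<noteq> 0} \<subseteq> \<Omega>"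

definition laplacian :: "('a::euclidean_space \<Rightarrow> real) \<Rightarrow> 'a \<Rightarrow> real" where
  "laplacian \<psi> x = (\<Sum>b\<in>Basis. partial_deriv b (partial_deriv b \<psi>) x)"

(* Delta y = g in Omega in the sense of distributions.  Used only for y and g continuous
   on the open set Omega, where both integrands are integrable. *)
definition distr_laplacian ::
    "'a::euclidean_space set \<Rightarrow> ('a \<Rightarrow> real) \<Rightarrow> ('a \<Rightarrow> real) \<Rightarrow> bool" where
  "distr_laplacian \<Omega> y g \<longleftrightarrow>
     (\<forall>\<psi>. test_function \<Omega> \<psi> \<longrightarrow>
        (LINT x:\<Omega>|lborel. y x * laplacian \<psi> x) = (LINT x:\<Omega>|lborel. g x * \<psi> x))"

(* y in C(closure Omega) with Delta y = g in Omega and y = 0 on the boundary. *)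
definition dirichlet_solution ::
    "'a::euclidean_space set \<Rightarrow> ('a \<Rightarrow> real) \<Rightarrow> ('a \<Rightarrow> real) \<Rightarrow> bool" where
  "dirichlet_solution \<Omega> g y \<longleftrightarrow>
     continuous_on (closure \<Omega>) y \<and> distr_laplacian \<Omega> y g \<and> (\<forall>x\<in>frontier \<Omega>. y x = 0)"

(* u solves the nonlinear problem, with v and w being its first and second iterated
   Laplacians; u determines v and w on the closure of Omega. *)
definition bvp_solution ::
    "'a::euclidean_space set \<Rightarrow> ('a \<times> real \<times> real \<times> real \<Rightarrow> real) \<Rightarrow>
      ('a \<Rightarrow> real) \<Rightarrow> ('a \<Rightarrow> real) \<Rightarrow> ('a \<Rightarrow> real) \<Rightarrow> bool" where
  "bvp_solution \<Omega> f u v w \<longleftrightarrow>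
     dirichlet_solution \<Omega> v u \<and> dirichlet_solution \<Omega> w v \<and>
     dirichlet_solution \<Omega> (\<lambda>x. f (x, u x, v x, w x)) w"

(* For nonempty compact K and y continuous on K the supremum is a maximum. *)
definition max_norm :: "'a::euclidean_space set \<Rightarrow> ('a \<Rightarrow> real) \<Rightarrow> real" where
  "max_norm K y = (SUP x\<in>K. \<bar>y x\<bar>)"

definition D_set ::
    "'a::euclidean_space set \<Rightarrow> real \<Rightarrow> real \<Rightarrow> ('a \<times> real \<times> real \<times> real) set" where
  "D_set \<Omega> C M =
     {(x, u, v, w). x \<in> \<Omega> \<and> \<bar>u\<bar> \<le> C ^ 3 * M \<and> \<bar>v\<bar> \<le> C\<^sup>2 * M \<and> \<bar>w\<bar> \<le> C * M}"

end

theory Submission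
  imports Defs
begin

text \<open>
  On right-hand sides bounded by \<open>M\<close>, the map that sends \<open>\<phi>\<close> to \<open>x \<mapsto> f (x, u x, v x, w x)\<close>, where \<open>w\<close>, \<open>v\<close>,
  \<open>u\<close> are obtained from \<open>\<phi>\<close> by solving three Dirichlet problems in a row, is a contraction in
  the maximum norm with constant \<open>q\<close>, and the right-hand side of the exact solution is its fixed
  point. Each Dirichlet problem gains a factor \<open>C\<close>, so \<open>u\<close>, \<open>v\<close>, \<open>w\<close> depend on \<open>\<phi>\<close> with
  constants \<open>C ^ 3\<close>, \<open>C\<^sup>2\<close>, \<open>C\<close>; with the Lipschitz condition on \<open>f\<close> this gives \<open>q\<close>, and
  the same bounds keep all iterates in the set on which \<open>f\<close> is controlled. The error estimate is
  then the a priori estimate of the contraction principle, multiplied by \<open>C ^ 3\<close>.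

  All the analysis is in one estimate (\<open>dirichlet_solution_le\<close> and
  \<open>dirichlet_solution_dist_le\<close>): a continuous \<open>y\<close> with \<open>\<Delta> y = g\<close> in the sense of
  distributions, \<open>y = 0\<close> on the boundary and \<open>\<bar>g\<bar> \<le> K\<close> satisfies \<open>\<bar>y\<bar> \<le> C * K\<close>. Classically
  it follows by comparing \<open>y\<close> with the paraboloid \<open>K (R\<^sup>2 - \<bar>x - c\<bar>\<^sup>2) / (2 n)\<close> and the maximum
  principle. Because \<open>y\<close> need not be differentiable, the maximum principle is proved here for a
  mollification: at its maximum point the second differences are at most 0, and these are
  integrals of the original function against second differences of a bump
  (\<open>exists_bump_nonpos_laplacian_integral\<close>). Dividing by the square of the step and letting the
  step tend to 0 turns them into the Laplacian of the bump (\<open>integral_laplacian_tendsto\<close>), which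
  is an admissible test function. For the paraboloid the integral against that Laplacian is
  computed by moving the second differences from one factor to the other by translation
  (\<open>integral_quadratic_laplacian\<close>).
\<close>

section \<open>A smooth bump function\<close>

text \<open>The powers of \<open>1 / s\<close> are built in so that derivatives are linear combinations of members of
  the family.\<close>

definition flat :: "nat \<Rightarrow> real \<Rightarrow> real" where
  "flat k s = (if s > 0 then exp (- 1 / s) / s ^ k else 0)"

lemma flat_nonneg: "0 \<le> flat k s" by (simp add: flat_def)

lemma flat_0_le_1: "flat 0 s \<le> 1" by (simp add: flat_def)

lemma tendsto_flat_at_0: "(flat k \<longlongrightarrow> 0) (at 0)"
proof -
  have "((\<lambda>s::real. exp (- 1 / s) / s ^ k) \<longlongrightarrow> 0) (at_right 0)"
    using filterlim_compose[OF tendsto_power_div_exp_0[of k] filterlim_inverse_at_top_right]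
    by (simp add: exp_minus field_simps)
  then have r: "(flat k \<longlongrightarrow> 0) (at_right 0)"
    by (rule Lim_transform_eventually)
       (auto simp: eventually_at_filter flat_def)
  have l: "(flat k \<longlongrightarrow> 0) (at_left 0)"
    by (rule tendsto_eventually) (auto simp: eventually_at_filter flat_def)
  show ?thesis using l r by (simp add: filterlim_split_at_real)
qed

lemma has_real_derivative_flat:
  "(flat k has_real_derivative flat (k + 2) s - real k * flat (k + 1) s) (at s)"
proof -
  consider "s < 0" | "s = 0" | "s > 0" by linarith
  then show ?thesis
  proof cases
    case 1
    have "((\<lambda>_. 0) has_real_derivative 0) (at s)" by simp
    then have "(flat k has_real_derivative 0) (at s)"
      by (rule has_field_derivative_transform_within_open[where S="{..<0}"])
         (use 1 in \<open>auto simp: flat_def\<close>)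
    then show ?thesis using 1 by (simp add: flat_def)
  next
    case 2
    \<comment> \<open>The difference quotient of \<open>flat k\<close> at 0 is \<open>flat (k + 1)\<close>.\<close>
    have "((\<lambda>h. (flat k (0 + h) - flat k 0) / h) \<longlongrightarrow> 0) (at 0)"
      by (rule Lim_transform_eventually[OF tendsto_flat_at_0[of "Suc k"]])
         (auto simp: eventually_at_filter flat_def)
    then show ?thesis using 2 by (simp add: DERIV_def flat_def)
  next
    case 3
    have "((\<lambda>s. exp (- 1 / s) / s ^ k) has_real_derivative
        exp (- 1 / s) / s ^ (k + 2) - real k * (exp (- 1 / s) / s ^ (k + 1))) (at s)"
      using 3
      by (cases k; auto intro!: derivative_eq_intros simp: field_simps power2_eq_square;
          metis Suc_pred neq0_conv power_Suc)
    then have "(flat k has_real_derivative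
        exp (- 1 / s) / s ^ (k + 2) - real k * (exp (- 1 / s) / s ^ (k + 1))) (at s)"
      by (rule has_field_derivative_transform_within_open[where S="{0<..}"])
         (use 3 in \<open>auto simp: flat_def\<close>)
    then show ?thesis using 3 by (simp add: flat_def)
  qed
qed

text \<open>Smoothness of a bump is a statement about all iterated partial derivatives. Computing them is
  avoided by exhibiting an algebra of functions that contains the bump and is stable under every
  directional derivative; each member of such an algebra is automatically smooth.\<close>

inductive_set bump_algebra :: "'a::euclidean_space \<Rightarrow> real \<Rightarrow> ('a \<Rightarrow> real) set"
  for a :: 'a and r :: real where
  const: "(\<lambda>_. d) \<in> bump_algebra a r"
| coord: "(\<lambda>x. x \<bullet> b) \<in> bump_algebra a r"
| flat: "(\<lambda>x. flat k (r\<^sup>2 - (norm (x - a))\<^sup>2)) \<in> bump_algebra a r"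
| add: "g \<in> bump_algebra a r \<Longrightarrow> h \<in> bump_algebra a r \<Longrightarrow> (\<lambda>x. g x + h x) \<in> bump_algebra a r"
| mult: "g \<in> bump_algebra a r \<Longrightarrow> h \<in> bump_algebra a r \<Longrightarrow> (\<lambda>x. g x * h x) \<in> bump_algebra a r"

lemma partial_deriv_eqI:
  "(g has_derivative D) (at x) \<Longrightarrow> partial_deriv b g x = D b"
  by (simp add: partial_deriv_def frechet_derivative_at[symmetric])

text \<open>By the chain rule, differentiating the generator \<open>flat k\<close> gives \<open>flat (k + 2)\<close> and
  \<open>flat (k + 1)\<close> times an affine function of \<open>x\<close>, so the derivative stays in the algebra; sums
  and products follow from the Leibniz rule.\<close>

lemma bump_algebra_derivative:
  assumes "g \<in> bump_algebra a r"
  shows "\<exists>g'. (\<forall>x. (g has_derivative (\<lambda>h. g' h x)) (at x)) \<and> (\<forall>b. g' b \<in> bump_algebra a r)"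
  using assms
proof induction
  case (const d)
  show ?case by (rule exI[of _ "\<lambda>h x. 0"]) (auto intro: bump_algebra.const)
next
  case (coord b)
  show ?case
    by (rule exI[of _ "\<lambda>h x. h \<bullet> b"])
       (auto intro!: bump_algebra.const derivative_eq_intros)
next
  case (flat k)
  let ?s = "\<lambda>x. r\<^sup>2 - (norm (x - a))\<^sup>2"
  let ?g' = "\<lambda>h x. (flat (k + 2) (?s x) + (- real k) * flat (k + 1) (?s x)) * ((-2) * (x \<bullet> h) + 2 * (a \<bullet> h))"
  have "((\<lambda>x. flat k (?s x)) has_derivative (\<lambda>h. ?g' h x)) (at x)" for x
  proof -
    have "(?s has_derivative (\<lambda>h. (-2) * (x \<bullet> h) + 2 * (a \<bullet> h))) (at x)"
      unfolding power2_norm_eq_inner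
      by (auto intro!: derivative_eq_intros simp: fun_eq_iff algebra_simps inner_commute)
    from has_derivative_compose[OF this
        has_real_derivative_flat[unfolded has_field_derivative_def, of k "?s x"]]
    show ?thesis by (simp add: o_def)
  qed
  then show ?case
    using bump_algebra.mult[OF bump_algebra.add[OF bump_algebra.flat
          bump_algebra.mult[OF bump_algebra.const bump_algebra.flat]]
        bump_algebra.add[OF bump_algebra.mult[OF bump_algebra.const bump_algebra.coord]
          bump_algebra.const]]
    by (intro exI[of _ ?g'] conjI allI) blast+
next
  case (add g h)
  then obtain g' h' where
    "\<forall>x. (g has_derivative (\<lambda>d. g' d x)) (at x)" "\<forall>b. g' b \<in> bump_algebra a r"
    "\<forall>x. (h has_derivative (\<lambda>d. h' d x)) (at x)" "\<forall>b. h' b \<in> bump_algebra a r" by auto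
  then show ?case
    by (intro exI[of _ "\<lambda>d x. g' d x + h' d x"])
       (auto intro!: bump_algebra.intros has_derivative_add)
next
  case (mult g h)
  then obtain g' h' where
    "\<forall>x. (g has_derivative (\<lambda>d. g' d x)) (at x)" "\<forall>b. g' b \<in> bump_algebra a r"
    "\<forall>x. (h has_derivative (\<lambda>d. h' d x)) (at x)" "\<forall>b. h' b \<in> bump_algebra a r" by auto
  then show ?case using mult.hyps
    by (intro exI[of _ "\<lambda>d x. g x * h' d x + g' d x * h x"])
       (auto intro!: bump_algebra.intros has_derivative_mult)
qed

lemma C_k_on_bump_algebra: "g \<in> bump_algebra a r \<Longrightarrow> C_k_on k UNIV g"
proof (induction k arbitrary: g)
  case (0 g)
  then obtain g' where "\<forall>x. (g has_derivative (\<lambda>h. g' h x)) (at x)"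
    using bump_algebra_derivative by blast
  then show ?case
    by (auto intro!: continuous_at_imp_continuous_on intro: has_derivative_continuous)
next
  case (Suc k g)
  then obtain g' where g': "\<forall>x. (g has_derivative (\<lambda>h. g' h x)) (at x)"
    "\<forall>b. g' b \<in> bump_algebra a r"
    using bump_algebra_derivative by blast
  have "partial_deriv b g = g' b" for b
    using partial_deriv_eqI[OF g'(1)[rule_format]] by auto
  then show ?case using g' Suc.IH by (auto simp: differentiable_def)
qed

definition bump :: "'a::euclidean_space \<Rightarrow> real \<Rightarrow> 'a \<Rightarrow> real" where
  "bump a r x = flat 0 (r\<^sup>2 - (norm (x - a))\<^sup>2)"

lemma bump_neq_0_iff: "r > 0 \<Longrightarrow> bump a r x \<noteq> 0 \<longleftrightarrow> x \<in> ball a r"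
  by (auto simp: bump_def flat_def dist_norm norm_minus_commute power_mono_iff
      abs_square_less_1 power2_less_imp_less intro: power_strict_mono)

lemma bump_nonneg: "0 \<le> bump a r x" and bump_le_1: "bump a r x \<le> 1"
  by (simp_all add: bump_def flat_nonneg flat_0_le_1)

lemma smooth_on_bump: "smooth_on UNIV (bump a r)"
  unfolding bump_def[abs_def] smooth_on_def
  by (blast intro: C_k_on_bump_algebra bump_algebra.flat)

lemma test_function_bump:
  assumes "r > 0" "cball a r \<subseteq> \<Omega>"
  shows "test_function \<Omega> (bump a r)"
proof -
  have "closure {x. bump a r x \<noteq> 0} = cball a r"
    using assms(1) by (simp only: bump_neq_0_iff[OF assms(1)] Collect_mem_eq closure_ball)
  then show ?thesis using assms by (simp add: test_function_def smooth_on_bump)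
qed

section \<open>Second differences as approximations of second derivatives\<close>

lemma smooth_on_partial_deriv:
  assumes "smooth_on S g" "b \<in> Basis"
  shows "smooth_on S (partial_deriv b g)"
  unfolding smooth_on_def
proof
  fix k
  have "C_k_on (Suc k) S g" using assms(1) unfolding smooth_on_def by blast
  then show "C_k_on k S (partial_deriv b g)" using assms(2) by simp
qed

lemma smooth_on_differentiable:
  assumes "smooth_on S g" "x \<in> S"
  shows "g differentiable (at x)"
proof -
  have "C_k_on (Suc 0) S g" using assms(1) unfolding smooth_on_def by blast
  then show ?thesis using assms(2) by simp
qed

lemma smooth_on_continuous_on:
  assumes "smooth_on S g"
  shows "continuous_on S g"
proof -
  have "C_k_on 0 S g" using assms unfolding smooth_on_def by blast
  then show ?thesis by simp
qed

lemma has_real_derivative_along_line: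
  assumes "smooth_on UNIV g"
  shows "((\<lambda>s. g (z + s *\<^sub>R b)) has_real_derivative partial_deriv b g (z + s *\<^sub>R b)) (at s)"
proof -
  let ?D = "frechet_derivative g (at (z + s *\<^sub>R b))"
  have D: "(g has_derivative ?D) (at (z + s *\<^sub>R b))"
    using smooth_on_differentiable[OF assms] by (simp add: frechet_derivative_works)
  have "((\<lambda>s. z + s *\<^sub>R b) has_derivative (\<lambda>h. h *\<^sub>R b)) (at s)"
    by (auto intro!: derivative_eq_intros)
  from has_derivative_compose[OF this D]
  have "((\<lambda>s. g (z + s *\<^sub>R b)) has_derivative (\<lambda>h. ?D (h *\<^sub>R b))) (at s)" .
  then show ?thesis
    unfolding has_field_derivative_def partial_deriv_def
    by (rule has_derivative_eq_rhs)
       (simp add: linear_scale[OF has_derivative_linear[OF D]] fun_eq_iff)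
qed

definition second_diff :: "('a::real_vector \<Rightarrow> real) \<Rightarrow> 'a \<Rightarrow> 'a \<Rightarrow> real" where
  "second_diff g h z = g (z + h) + g (z - h) - 2 * g z"

text \<open>Taylor expansion of order two at \<open>t\<close> and at \<open>- t\<close>: the first-order terms cancel, and the two
  remainders evaluate the second derivative at intermediate points. This form gives both the
  pointwise limit of the second difference quotient and a bound uniform in \<open>t\<close>.\<close>

lemma second_diff_mean_value:
  assumes "smooth_on UNIV g" "b \<in> Basis"
  obtains \<xi> \<eta> where "\<bar>\<xi>\<bar> \<le> \<bar>t\<bar>" "\<bar>\<eta>\<bar> \<le> \<bar>t\<bar>"
    "second_diff g (t *\<^sub>R b) z = t\<^sup>2 * ((partial_deriv b (partial_deriv b g) (z + \<xi> *\<^sub>R b)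
       + partial_deriv b (partial_deriv b g) (z + \<eta> *\<^sub>R b)) / 2)"
proof -
  let ?g1 = "partial_deriv b g" and ?g2 = "partial_deriv b (partial_deriv b g)"
  define d where "d m s = (if m = 0 then g (z + s *\<^sub>R b) else
      if m = Suc 0 then ?g1 (z + s *\<^sub>R b) else ?g2 (z + s *\<^sub>R b))" for m :: nat and s
  have "\<exists>\<xi>. \<bar>\<xi>\<bar> \<le> \<bar>\<tau>\<bar> \<and> g (z + \<tau> *\<^sub>R b) = (\<Sum>m<2. d m 0 / fact m * \<tau> ^ m) + d 2 \<xi> / fact 2 * \<tau> ^ 2"
    for \<tau>
  proof (rule Maclaurin_bi_le)
    show "d 0 = (\<lambda>\<tau>. g (z + \<tau> *\<^sub>R b))" by (simp add: d_def fun_eq_iff)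
    show "\<forall>m s. m < 2 \<and> \<bar>s\<bar> \<le> \<bar>\<tau>\<bar> \<longrightarrow> (d m has_real_derivative d (Suc m) s) (at s)"
      using has_real_derivative_along_line[OF assms(1)]
        has_real_derivative_along_line[OF smooth_on_partial_deriv[OF assms]]
      by (auto simp: d_def[abs_def] less_2_cases_iff)
  qed
  moreover have "(\<Sum>m<2. F m) = F 0 + F (Suc 0)" for F :: "nat \<Rightarrow> real"
    by (simp add: eval_nat_numeral)
  ultimately have taylor: "\<exists>\<xi>. \<bar>\<xi>\<bar> \<le> \<bar>\<tau>\<bar> \<and>
      g (z + \<tau> *\<^sub>R b) = g z + ?g1 z * \<tau> + ?g2 (z + \<xi> *\<^sub>R b) / 2 * \<tau>\<^sup>2" for \<tau>
    by (simp add: d_def)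
  obtain \<xi> where \<xi>: "\<bar>\<xi>\<bar> \<le> \<bar>t\<bar>"
    "g (z + t *\<^sub>R b) = g z + ?g1 z * t + ?g2 (z + \<xi> *\<^sub>R b) / 2 * t\<^sup>2"
    using taylor by blast
  obtain \<eta> where \<eta>: "\<bar>\<eta>\<bar> \<le> \<bar>t\<bar>"
    "g (z - t *\<^sub>R b) = g z - ?g1 z * t + ?g2 (z + \<eta> *\<^sub>R b) / 2 * t\<^sup>2"
    using taylor[of "- t"] unfolding scaleR_minus_left add_uminus_conv_diff abs_minus_cancel
      power2_minus mult_minus_right by blast
  have "second_diff g (t *\<^sub>R b) z = t\<^sup>2 * ((?g2 (z + \<xi> *\<^sub>R b) + ?g2 (z + \<eta> *\<^sub>R b)) / 2)"
    unfolding second_diff_def \<xi>(2) \<eta>(2) by (simp add: algebra_simps add_divide_distrib)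
  with \<xi>(1) \<eta>(1) show thesis by (rule that)
qed

lemma second_diff_quotient_tendsto:
  assumes "smooth_on UNIV g" "b \<in> Basis"
  shows "((\<lambda>t. second_diff g (t *\<^sub>R b) z / t\<^sup>2) \<longlongrightarrow> partial_deriv b (partial_deriv b g) z) (at 0)"
proof -
  let ?g2 = "partial_deriv b (partial_deriv b g)"
  have "continuous_on UNIV ?g2"
    using assms by (intro smooth_on_continuous_on smooth_on_partial_deriv)
  then have "continuous_on UNIV (\<lambda>s. ?g2 (z + s *\<^sub>R b))"
    by (rule continuous_on_compose2) (auto intro!: continuous_intros)
  then have cont: "isCont (\<lambda>s. ?g2 (z + s *\<^sub>R b)) 0"
    by (simp add: continuous_on_eq_continuous_at)
  show ?thesis
  proof (rule tendstoI)
    fix e :: real assume "e > 0"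
    with cont obtain \<delta> where \<delta>: "\<delta> > 0" "\<And>s. \<bar>s\<bar> < \<delta> \<Longrightarrow> \<bar>?g2 (z + s *\<^sub>R b) - ?g2 z\<bar> < e"
      unfolding continuous_at_eps_delta by (auto simp: dist_real_def)
    have "dist (second_diff g (t *\<^sub>R b) z / t\<^sup>2) (?g2 z) < e" if t: "t \<noteq> 0" "\<bar>t\<bar> < \<delta>" for t
    proof -
      obtain \<xi> \<eta> where *: "\<bar>\<xi>\<bar> \<le> \<bar>t\<bar>" "\<bar>\<eta>\<bar> \<le> \<bar>t\<bar>"
        "second_diff g (t *\<^sub>R b) z = t\<^sup>2 * ((?g2 (z + \<xi> *\<^sub>R b) + ?g2 (z + \<eta> *\<^sub>R b)) / 2)"
        using second_diff_mean_value[OF assms] .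
      have "second_diff g (t *\<^sub>R b) z / t\<^sup>2 = (?g2 (z + \<xi> *\<^sub>R b) + ?g2 (z + \<eta> *\<^sub>R b)) / 2"
        unfolding *(3) using t by simp
      moreover have "\<bar>(p + p') / 2 - d\<bar> < e" if "\<bar>p - d\<bar> < e" "\<bar>p' - d\<bar> < e" for p p' d :: real
        using that by (auto simp: abs_less_iff field_simps)
      moreover have "\<bar>?g2 (z + \<xi> *\<^sub>R b) - ?g2 z\<bar> < e" "\<bar>?g2 (z + \<eta> *\<^sub>R b) - ?g2 z\<bar> < e"
        using \<delta>(2) *(1,2) t(2) by (meson order_le_less_trans)+
      ultimately show ?thesis
        unfolding dist_real_def by metis
    qed
    then show "\<forall>\<^sub>F t in at 0. dist (second_diff g (t *\<^sub>R b) z / t\<^sup>2) (?g2 z) < e"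
      using \<delta>(1) by (auto simp: eventually_at intro!: exI[of _ \<delta>])
  qed
qed

lemma integrable_continuous_compact_support:
  fixes g :: "'a::euclidean_space \<Rightarrow> real"
  assumes "continuous_on UNIV g" "\<And>x. x \<notin> cball 0 r \<Longrightarrow> g x = 0"
  shows "integrable lborel g"
proof -
  have "integrable lborel (\<lambda>x. indicator (cball 0 r) x *\<^sub>R g x)"
    by (rule borel_integrable_compact) (auto intro: continuous_on_subset[OF assms(1)])
  moreover have "(\<lambda>x. indicator (cball 0 r) x *\<^sub>R g x) = g"
    using assms(2) by (auto simp: fun_eq_iff indicator_def)
  ultimately show ?thesis by simp
qed

text \<open>Dominated convergence: for step sizes at most 1 the quotients vanish outside the ball of radius
  \<open>r + 1\<close>, and there the mean value form bounds them by the maximum of the second derivative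
  over the ball of radius \<open>r + 2\<close>.\<close>

lemma integral_second_diff_tendsto:
  fixes G \<psi> :: "'a::euclidean_space \<Rightarrow> real"
  assumes G: "continuous_on UNIV G" and \<psi>: "smooth_on UNIV \<psi>" and b: "b \<in> Basis"
    and supp: "\<And>x. x \<notin> cball 0 r \<Longrightarrow> \<psi> x = 0"
  shows "integrable lborel (\<lambda>z. G z * partial_deriv b (partial_deriv b \<psi>) z)"
    and "(\<lambda>n. \<integral>z. G z * (second_diff \<psi> (inverse (real (Suc n)) *\<^sub>R b) z / (inverse (real (Suc n)))\<^sup>2) \<partial>lborel)
      \<longlonglongrightarrow> (\<integral>z. G z * partial_deriv b (partial_deriv b \<psi>) z \<partial>lborel)"
proof -
  let ?D = "partial_deriv b (partial_deriv b \<psi>)"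
  define t where "t n = inverse (real (Suc n))" for n
  have t: "0 < t n" "t n \<le> 1" for n by (auto simp: t_def field_simps)
  have t0: "filterlim t (at 0) sequentially"
    unfolding filterlim_at using LIMSEQ_inverse_real_of_nat t by (auto simp: t_def[abs_def])
  have contD: "continuous_on UNIV ?D" and cont\<psi>: "continuous_on UNIV \<psi>"
    using \<psi> b by (auto intro: smooth_on_continuous_on smooth_on_partial_deriv)
  have "bounded (?D ` cball 0 (r + 2))"
    by (intro compact_imp_bounded compact_continuous_image continuous_on_subset[OF contD]) auto
  then obtain B where B: "B > 0" "\<And>x. norm x \<le> r + 2 \<Longrightarrow> \<bar>?D x\<bar> \<le> B"
    by (auto simp: bounded_pos)
  have bound: "norm (G z * (second_diff \<psi> (t n *\<^sub>R b) z / (t n)\<^sup>2)) \<le>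
      indicator (cball 0 (r + 1)) z * (B * \<bar>G z\<bar>)" for z n
  proof (cases "norm z \<le> r + 1")
    case True
    obtain \<xi> \<eta> where *: "\<bar>\<xi>\<bar> \<le> \<bar>t n\<bar>" "\<bar>\<eta>\<bar> \<le> \<bar>t n\<bar>"
      "second_diff \<psi> (t n *\<^sub>R b) z = (t n)\<^sup>2 * ((?D (z + \<xi> *\<^sub>R b) + ?D (z + \<eta> *\<^sub>R b)) / 2)"
      using second_diff_mean_value[OF \<psi> b] .
    have "\<bar>?D (z + s *\<^sub>R b)\<bar> \<le> B" if "\<bar>s\<bar> \<le> \<bar>t n\<bar>" for s
      using norm_triangle_ineq[of z "s *\<^sub>R b"] True that t[of n] b by (intro B(2)) auto
    from this[OF *(1)] this[OF *(2)]
    have "\<bar>second_diff \<psi> (t n *\<^sub>R b) z / (t n)\<^sup>2\<bar> \<le> B"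
      unfolding *(3) using t(1)[of n] by simp
    then have "\<bar>G z\<bar> * \<bar>second_diff \<psi> (t n *\<^sub>R b) z / (t n)\<^sup>2\<bar> \<le> \<bar>G z\<bar> * B"
      by (rule mult_left_mono) simp
    then show ?thesis
      using True by (simp only: real_norm_def abs_mult indicator_simps mem_cball_0 mult_1 mult.commute[of B])
  next
    case False
    have "norm (t n *\<^sub>R b) \<le> 1" using t[of n] b by simp
    then have "norm (z + t n *\<^sub>R b) > r" "norm (z - t n *\<^sub>R b) > r" "norm z > r"
      using False norm_triangle_ineq4[of "z + t n *\<^sub>R b" "t n *\<^sub>R b"]
        norm_triangle_ineq[of "z - t n *\<^sub>R b" "t n *\<^sub>R b"] by auto
    then have "second_diff \<psi> (t n *\<^sub>R b) z = 0"
      using supp by (simp add: second_diff_def)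
    then show ?thesis using B(1) by (simp add: indicator_def)
  qed
  have [measurable]: "G \<in> borel_measurable borel" "\<psi> \<in> borel_measurable borel"
      "?D \<in> borel_measurable borel"
    using G cont\<psi> contD by (auto intro: borel_measurable_continuous_onI)
  have meas: "(\<lambda>z. G z * (second_diff \<psi> (t n *\<^sub>R b) z / (t n)\<^sup>2)) \<in> borel_measurable lborel" for n
    unfolding second_diff_def by measurable
  have measD: "(\<lambda>z. G z * ?D z) \<in> borel_measurable lborel" by measurable
  have lim: "AE z in lborel. (\<lambda>n. G z * (second_diff \<psi> (t n *\<^sub>R b) z / (t n)\<^sup>2)) \<longlonglongrightarrow> G z * ?D z"
    by (intro AE_I2 tendsto_mult tendsto_const
        filterlim_compose[OF second_diff_quotient_tendsto[OF \<psi> b] t0])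
  have dom: "integrable lborel (\<lambda>z. indicator (cball 0 (r + 1)) z * (B * \<bar>G z\<bar>))"
    using borel_integrable_compact[of "cball 0 (r + 1)" "\<lambda>z. B * \<bar>G z\<bar>"]
      continuous_on_subset[OF G subset_UNIV]
    by (simp add: continuous_on_mult_left continuous_on_rabs)
  show "integrable lborel (\<lambda>z. G z * ?D z)"
    by (rule integrable_dominated_convergence[OF measD meas dom lim AE_I2[OF bound]])
  have "(\<lambda>n. \<integral>z. G z * (second_diff \<psi> (t n *\<^sub>R b) z / (t n)\<^sup>2) \<partial>lborel)
      \<longlonglongrightarrow> (\<integral>z. G z * ?D z \<partial>lborel)"
    by (rule integral_dominated_convergence[OF measD meas dom lim AE_I2[OF bound]])
  then show "(\<lambda>n. \<integral>z. G z * (second_diff \<psi> (inverse (real (Suc n)) *\<^sub>R b) z / (inverse (real (Suc n)))\<^sup>2) \<partial>lborel)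
      \<longlonglongrightarrow> (\<integral>z. G z * ?D z \<partial>lborel)"
    by (simp only: t_def)
qed

lemma integral_lborel_translate:
  fixes F :: "'a::euclidean_space \<Rightarrow> real"
  assumes [measurable]: "F \<in> borel_measurable borel"
  shows "(\<integral>z. F (c + z) \<partial>lborel) = (\<integral>z. F z \<partial>lborel)"
proof -
  have "(\<integral>z. F z \<partial>lborel) = (\<integral>z. F z \<partial>(distr lborel borel ((+) c)))"
    by (simp add: lborel_distr_plus)
  also have "\<dots> = (\<integral>z. F (c + z) \<partial>lborel)"
    by (rule integral_distr) auto
  finally show ?thesis by simp
qed

text \<open>The discrete form of integrating by parts twice, by translation invariance of Lebesgue
  measure; it applies to every continuous \<open>G\<close>.\<close>

lemma integral_second_diff_swap:
  fixes G \<psi> :: "'a::euclidean_space \<Rightarrow> real"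
  assumes G: "continuous_on UNIV G" and \<psi>: "continuous_on UNIV \<psi>"
    and supp: "\<And>x. x \<notin> cball 0 r \<Longrightarrow> \<psi> x = 0"
  shows "(\<integral>z. G z * second_diff \<psi> h z \<partial>lborel) = (\<integral>z. second_diff G h z * \<psi> z \<partial>lborel)"
proof -
  have [measurable]: "G \<in> borel_measurable borel" "\<psi> \<in> borel_measurable borel"
    using G \<psi> by (auto intro: borel_measurable_continuous_onI)
  have shiftG: "continuous_on UNIV (\<lambda>z. G (z + k))"
    and shift\<psi>: "continuous_on UNIV (\<lambda>z. \<psi> (z + k))" for k :: 'a
    by (intro continuous_on_compose2[OF G] continuous_on_compose2[OF \<psi>] continuous_intros; simp)+
  have i1: "integrable lborel (\<lambda>z. G z * \<psi> (z + k))" for k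
  proof (rule integrable_continuous_compact_support[where r = "r + norm k"])
    fix z :: 'a assume "z \<notin> cball 0 (r + norm k)"
    then have "z + k \<notin> cball 0 r"
      using norm_triangle_ineq4[of "z + k" k] by auto
    then show "G z * \<psi> (z + k) = 0" using supp by simp
  qed (intro continuous_on_mult G shift\<psi>)
  have i2: "integrable lborel (\<lambda>z. G (z + k) * \<psi> z)" for k
    by (rule integrable_continuous_compact_support[where r = r])
       (use supp in \<open>auto intro!: continuous_on_mult shiftG \<psi>\<close>)
  have sw: "(\<integral>z. G z * \<psi> (z + k) \<partial>lborel) = (\<integral>z. G (z + - k) * \<psi> z \<partial>lborel)" for k
    using integral_lborel_translate[of "\<lambda>z. G (z + - k) * \<psi> z" k] by (simp add: add.commute)
  have lin: "(\<integral>z. F z + F' z - 2 * F'' z \<partial>lborel) =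
      (\<integral>z. F z \<partial>lborel) + (\<integral>z. F' z \<partial>lborel) - 2 * (\<integral>z. F'' z \<partial>lborel)"
    if "integrable lborel F" "integrable lborel F'" "integrable lborel F''" for F F' F'' :: "'a \<Rightarrow> real"
    using that by simp
  have "(\<integral>z. G z * second_diff \<psi> h z \<partial>lborel) =
      (\<integral>z. G z * \<psi> (z + h) + G z * \<psi> (z + - h) - 2 * (G z * \<psi> (z + 0)) \<partial>lborel)"
    by (simp add: second_diff_def algebra_simps)
  also have "\<dots> = (\<integral>z. G z * \<psi> (z + h) \<partial>lborel) + (\<integral>z. G z * \<psi> (z + - h) \<partial>lborel)
      - 2 * (\<integral>z. G z * \<psi> (z + 0) \<partial>lborel)"
    by (rule lin[OF i1 i1 i1])
  also have "\<dots> = (\<integral>z. G (z + - h) * \<psi> z \<partial>lborel) + (\<integral>z. G (z + - (- h)) * \<psi> z \<partial>lborel)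
      - 2 * (\<integral>z. G (z + - 0) * \<psi> z \<partial>lborel)"
    by (simp only: sw)
  also have "\<dots> = (\<integral>z. G (z + - h) * \<psi> z + G (z + - (- h)) * \<psi> z - 2 * (G (z + - 0) * \<psi> z) \<partial>lborel)"
    by (rule lin[OF i2 i2 i2, symmetric])
  also have "\<dots> = (\<integral>z. second_diff G h z * \<psi> z \<partial>lborel)"
    by (simp add: second_diff_def algebra_simps)
  finally show ?thesis .
qed

text \<open>The parallelogram law.\<close>

lemma second_diff_norm_square:
  fixes c :: "'a::real_inner"
  shows "second_diff (\<lambda>z. (norm (z - c))\<^sup>2) h z = 2 * (norm h)\<^sup>2"
proof -
  have eq: "z + h - c = (z - c) + h" "z - h - c = (z - c) - h" by simp_all
  show ?thesis
    unfolding second_diff_def eq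
    using dot_norm[of "z - c" h] dot_norm_neg[of "z - c" h] by (simp add: field_simps)
qed

section \<open>Testing a continuous function with the Laplacian\<close>

lemma partial_deriv_eq_0_on_open:
  assumes "open U" "x \<in> U" "\<And>y. y \<in> U \<Longrightarrow> g y = 0"
  shows "partial_deriv b g x = 0"
proof (rule partial_deriv_eqI)
  show "(g has_derivative (\<lambda>_. 0)) (at x)"
    by (rule has_derivative_transform_within_open[OF _ assms(1,2), of "\<lambda>_. 0"])
       (simp_all add: assms(3))
qed

lemma laplacian_eq_0_outside_support:
  assumes "x \<notin> closure {y. \<psi> y \<noteq> 0}"
  shows "laplacian \<psi> x = 0"
proof -
  let ?U = "- closure {y. \<psi> y \<noteq> 0}"
  have \<psi>: "\<psi> y = 0" if "y \<in> ?U" for y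
    using that closure_subset[of "{y. \<psi> y \<noteq> 0}"] by blast
  have U: "open ?U" "x \<in> ?U" using assms open_Compl[OF closed_closure] by blast+
  have "partial_deriv b \<psi> y = 0" if "y \<in> ?U" for y b
    by (rule partial_deriv_eq_0_on_open[OF U(1) that \<psi>])
  then have "partial_deriv b (partial_deriv b \<psi>) x = 0" for b
    by (rule partial_deriv_eq_0_on_open[OF U])
  then show ?thesis by (simp add: laplacian_def)
qed

lemma continuous_on_laplacian: "smooth_on UNIV \<psi> \<Longrightarrow> continuous_on UNIV (laplacian \<psi>)"
  unfolding laplacian_def[abs_def]
  by (intro continuous_on_sum smooth_on_continuous_on smooth_on_partial_deriv)

text \<open>For a function \<open>G\<close> that is merely continuous, its distributional Laplacian tested with
  \<open>\<psi>\<close> is the limit of integrals against second differences; everything needed about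
  \<open>G\<close> can therefore be read off at positive step size.\<close>

lemma integral_laplacian_tendsto:
  fixes G \<psi> :: "'a::euclidean_space \<Rightarrow> real"
  assumes G: "continuous_on UNIV G" and \<psi>: "smooth_on UNIV \<psi>"
    and supp: "\<And>x. x \<notin> cball 0 r \<Longrightarrow> \<psi> x = 0"
  shows "integrable lborel (\<lambda>z. G z * laplacian \<psi> z)"
    and "(\<lambda>n. \<Sum>b\<in>Basis. (\<integral>z. G z * second_diff \<psi> (inverse (real (Suc n)) *\<^sub>R b) z \<partial>lborel)
            / (inverse (real (Suc n)))\<^sup>2)
      \<longlonglongrightarrow> (\<integral>z. G z * laplacian \<psi> z \<partial>lborel)"
proof -
  let ?D = "\<lambda>b. partial_deriv b (partial_deriv b \<psi>)"
  have int: "integrable lborel (\<lambda>z. G z * ?D b z)" if "b \<in> Basis" for b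
    using integral_second_diff_tendsto(1)[OF G \<psi> that supp] .
  show "integrable lborel (\<lambda>z. G z * laplacian \<psi> z)"
    unfolding laplacian_def sum_distrib_left by (intro Bochner_Integration.integrable_sum int)
  have "(\<integral>z. G z * laplacian \<psi> z \<partial>lborel) = (\<Sum>b\<in>Basis. \<integral>z. G z * ?D b z \<partial>lborel)"
    unfolding laplacian_def sum_distrib_left by (intro Bochner_Integration.integral_sum int)
  moreover have "(\<lambda>n. \<Sum>b\<in>Basis. (\<integral>z. G z * second_diff \<psi> (inverse (real (Suc n)) *\<^sub>R b) z \<partial>lborel)
        / (inverse (real (Suc n)))\<^sup>2) \<longlonglongrightarrow> (\<Sum>b\<in>Basis. \<integral>z. G z * ?D b z \<partial>lborel)"
  proof (rule tendsto_sum)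
    fix b :: 'a assume b: "b \<in> Basis"
    show "(\<lambda>n. (\<integral>z. G z * second_diff \<psi> (inverse (real (Suc n)) *\<^sub>R b) z \<partial>lborel)
        / (inverse (real (Suc n)))\<^sup>2) \<longlonglongrightarrow> (\<integral>z. G z * ?D b z \<partial>lborel)"
      using integral_second_diff_tendsto(2)[OF G \<psi> b supp]
      by (simp only: times_divide_eq_right integral_divide_zero)
  qed
  ultimately show "(\<lambda>n. \<Sum>b\<in>Basis. (\<integral>z. G z * second_diff \<psi> (inverse (real (Suc n)) *\<^sub>R b) z \<partial>lborel)
            / (inverse (real (Suc n)))\<^sup>2)
      \<longlonglongrightarrow> (\<integral>z. G z * laplacian \<psi> z \<partial>lborel)" by simp
qed

text \<open>A quadratic polynomial has constant second differences, so moving them from \<open>\<psi>\<close> to \<open>G\<close>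
  gives every approximating sum the same value.\<close>

lemma integral_quadratic_laplacian:
  fixes G \<psi> :: "'a::euclidean_space \<Rightarrow> real"
  assumes G: "continuous_on UNIV G" and \<psi>: "smooth_on UNIV \<psi>"
    and supp: "\<And>x. x \<notin> cball 0 r \<Longrightarrow> \<psi> x = 0"
    and quad: "\<And>h z. second_diff G h z = \<kappa> * (norm h)\<^sup>2"
  shows "(\<integral>z. G z * laplacian \<psi> z \<partial>lborel) = \<kappa> * real DIM('a) * (\<integral>z. \<psi> z \<partial>lborel)"
proof -
  have "(\<integral>z. G z * second_diff \<psi> (t *\<^sub>R b) z \<partial>lborel) / t\<^sup>2 = \<kappa> * (\<integral>z. \<psi> z \<partial>lborel)"
    if "b \<in> Basis" "t \<noteq> 0" for b t
  proof -
    have "(\<integral>z. G z * second_diff \<psi> (t *\<^sub>R b) z \<partial>lborel) = (\<integral>z. (\<kappa> * t\<^sup>2) * \<psi> z \<partial>lborel)"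
      using integral_second_diff_swap[OF G smooth_on_continuous_on[OF \<psi>] supp] that(1)
      by (simp add: quad)
    then show ?thesis using that(2) by simp
  qed
  then have "(\<lambda>n::nat. \<Sum>b\<in>(Basis::'a set). \<kappa> * (\<integral>z. \<psi> z \<partial>lborel)) \<longlonglongrightarrow> (\<integral>z. G z * laplacian \<psi> z \<partial>lborel)"
    using integral_laplacian_tendsto(2)[OF G \<psi> supp] by simp
  then have "(\<Sum>b\<in>(Basis::'a set). \<kappa> * (\<integral>z. \<psi> z \<partial>lborel)) = (\<integral>z. G z * laplacian \<psi> z \<partial>lborel)"
    by (simp add: LIMSEQ_const_iff)
  then show ?thesis by (simp add: mult_ac)
qed

section \<open>A maximum principle for mollified functions\<close>

lemma continuous_on_bump: "continuous_on UNIV (bump a r)"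
  by (rule smooth_on_continuous_on[OF smooth_on_bump])

lemma bump_eq_0: "r > 0 \<Longrightarrow> x \<notin> ball a r \<Longrightarrow> bump a r x = 0"
  using bump_neq_0_iff by blast

lemma bump_eq_0_cball: "r > 0 \<Longrightarrow> x \<notin> cball 0 (norm a + r) \<Longrightarrow> bump a r x = 0"
  using norm_triangle_ineq2[of x a] by (intro bump_eq_0) (auto simp: dist_norm norm_minus_commute)

lemma bump_shift: "bump (a - h) r z = bump a r (z + h)"
  by (simp add: bump_def algebra_simps)

lemma integrable_mult_bump:
  assumes "continuous_on UNIV G" "r > 0"
  shows "integrable lborel (\<lambda>z. G z * bump a r z)"
proof (rule integrable_continuous_compact_support)
  show "continuous_on UNIV (\<lambda>z. G z * bump a r z)"
    by (intro continuous_on_mult assms(1) continuous_on_bump)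
  show "G z * bump a r z = 0" if "z \<notin> cball 0 (norm a + r)" for z
    using bump_eq_0_cball[OF assms(2) that] by simp
qed

lemma integral_bump_pos:
  fixes a :: "'a::euclidean_space"
  assumes "r > 0"
  shows "0 < (\<integral>z. bump a r z \<partial>lborel)"
proof -
  have int: "integrable lborel (bump a r)"
    using integrable_mult_bump[of "\<lambda>_. 1" r a] assms by simp
  have "(\<integral>z. bump a r z \<partial>lborel) \<noteq> 0"
  proof
    assume "(\<integral>z. bump a r z \<partial>lborel) = 0"
    then have "AE z in lborel. bump a r z = 0"
      using integral_nonneg_eq_0_iff_AE[OF int] bump_nonneg by auto
    then have "AE z in lborel. z \<notin> ball a r"
      using bump_neq_0_iff[OF assms, of a] by (auto elim!: eventually_mono)
    then have "ball a r \<in> null_sets lborel"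
      using AE_iff_null_sets[of "ball a r" lborel] by simp
    then show False
      using content_ball_pos[OF assms, of a] by (simp add: measure_def null_setsD1)
  qed
  moreover have "0 \<le> (\<integral>z. bump a r z \<partial>lborel)"
    by (simp add: bump_nonneg)
  ultimately show ?thesis by linarith
qed

lemma integral_bump_translate:
  fixes a :: "'a::euclidean_space"
  shows "(\<integral>z. bump a r z \<partial>lborel) = (\<integral>z. bump (0::'a) r z \<partial>lborel)"
proof -
  have "(\<lambda>z. bump a r z) = (\<lambda>z. bump 0 r (- a + z))"
    by (simp add: bump_def fun_eq_iff)
  then show ?thesis
    by (simp only: integral_lborel_translate[OF borel_measurable_continuous_onI[OF continuous_on_bump]])
qed

text \<open>The maximum principle for a continuous function. Mollify \<open>G\<close> by bumps
  of small radius \<open>\<epsilon>\<close>, that is, put \<open>H x = \<integral> G z * bump x \<epsilon> z\<close>, and let \<open>a\<close> be a maximum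
  point of \<open>H\<close>. All second differences of \<open>H\<close> at \<open>a\<close> are at most 0; by translation
  they are the integrals of \<open>G\<close> against the second differences of \<open>bump a \<epsilon>\<close>, and the limit of
  these gives the inequality. Since the mollified maximum is close to the maximum of \<open>G\<close>,
  uniform continuity makes \<open>G\<close> positive on the whole support of the bump.\<close>

lemma exists_bump_nonpos_laplacian_integral:
  fixes G :: "'a::euclidean_space \<Rightarrow> real"
  assumes G: "continuous_on UNIV G" and supp: "\<And>x. x \<notin> cball 0 r \<Longrightarrow> G x = 0"
    and nonneg: "\<And>x. 0 \<le> G x" and pos: "0 < G x0"
  shows "\<exists>a \<epsilon>. \<epsilon> > 0 \<and> (\<forall>z\<in>cball a \<epsilon>. G z > 0) \<and>
    (\<integral>z. G z * laplacian (bump a \<epsilon>) z \<partial>lborel) \<le> 0"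
proof -
  have x0: "x0 \<in> cball 0 r" using pos supp by fastforce
  have contG: "continuous_on S G" for S
    by (rule continuous_on_subset[OF G subset_UNIV])
  obtain p where p: "p \<in> cball 0 r" "\<And>x. x \<in> cball 0 r \<Longrightarrow> G x \<le> G p"
    using continuous_attains_sup[OF compact_cball _ contG, of 0 r] x0 by blast
  define m where "m = G p"
  have m: "m > 0" using p(2)[OF x0] pos by (simp add: m_def)
  have Gm: "G x \<le> m" for x
    using p(2)[of x] supp[of x] m by (cases "x \<in> cball 0 r") (auto simp: m_def)
  have "uniformly_continuous_on (cball 0 (r + 1)) G"
    by (intro compact_uniformly_continuous contG) simp
  then have "\<exists>d>0. \<forall>x\<in>cball 0 (r + 1). \<forall>y\<in>cball 0 (r + 1). dist y x < d \<longrightarrow> dist (G y) (G x) < m / 4"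
    unfolding uniformly_continuous_on_def by (rule allE[of _ "m / 4"]) (use m in simp)
  then obtain \<delta>0 where \<delta>0: "\<delta>0 > 0" "\<And>x y. x \<in> cball 0 (r + 1) \<Longrightarrow> y \<in> cball 0 (r + 1) \<Longrightarrow>
      dist y x < \<delta>0 \<Longrightarrow> dist (G y) (G x) < m / 4"
    by blast
  \<comment> \<open>Two points of a ball of radius \<open>\<epsilon>\<close> are closer than \<open>\<delta>0\<close>, and points within \<open>2 * \<epsilon>\<close>
    of the support of \<open>G\<close> stay where the uniform continuity was taken.\<close>
  define \<epsilon> where "\<epsilon> = min 1 \<delta>0 / 3"
  have \<epsilon>: "\<epsilon> > 0" "2 * \<epsilon> < 1" "2 * \<epsilon> < \<delta>0" using \<delta>0(1) by (auto simp: \<epsilon>_def min_def)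
  have near: "G x - m / 4 < G y" if "x \<in> cball 0 r" "dist y x \<le> 2 * \<epsilon>" for x y
  proof -
    have "norm y \<le> norm x + dist y x"
      using norm_triangle_ineq[of x "y - x"] by (simp add: dist_norm)
    then have "dist (G y) (G x) < m / 4" using that \<epsilon> by (intro \<delta>0(2)) auto
    then show ?thesis unfolding dist_real_def by linarith
  qed
  define J where "J = (\<integral>z. bump (0::'a) \<epsilon> z \<partial>lborel)"
  have J: "J > 0" "(\<integral>z. bump x \<epsilon> z \<partial>lborel) = J" for x :: 'a
    using integral_bump_pos[OF \<epsilon>(1), of 0] integral_bump_translate[of x] by (simp_all add: J_def)
  define H where "H x = (\<integral>z. G z * bump x \<epsilon> z \<partial>lborel)" for x
  have intGb: "integrable lborel (\<lambda>z. G z * bump x \<epsilon> z)" for x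
    using integrable_mult_bump[OF G \<epsilon>(1)] .
  have intb: "integrable lborel (\<lambda>z. d * bump x \<epsilon> z)" for d and x :: 'a
    using integrable_mult_bump[OF _ \<epsilon>(1), of "\<lambda>_. d"] by simp
  have [measurable]: "G \<in> borel_measurable borel" "bump x \<epsilon> \<in> borel_measurable borel" for x :: 'a
    using G continuous_on_bump by (auto intro: borel_measurable_continuous_onI)
  have "continuous_on UNIV H"
    unfolding continuous_on_sequentially
  proof (intro allI ballI impI, elim conjE)
    fix X :: "nat \<Rightarrow> 'a" and x assume X: "X \<longlonglongrightarrow> x"
    have lim: "(\<lambda>n. bump (X n) \<epsilon> z) \<longlonglongrightarrow> bump x \<epsilon> z" for z
    proof -
      have "(\<lambda>n. \<epsilon>\<^sup>2 - (norm (z - X n))\<^sup>2) \<longlonglongrightarrow> \<epsilon>\<^sup>2 - (norm (z - x))\<^sup>2"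
        by (intro tendsto_intros X)
      then show ?thesis
        unfolding bump_def
        by (rule isCont_tendsto_compose[OF DERIV_isCont[OF has_real_derivative_flat]])
    qed
    have "(\<lambda>n. H (X n)) \<longlonglongrightarrow> H x"
      unfolding H_def
    proof (rule integral_dominated_convergence[where w = G])
      show "integrable lborel G" using integrable_continuous_compact_support[OF G supp] .
      show "AE z in lborel. (\<lambda>n. G z * bump (X n) \<epsilon> z) \<longlonglongrightarrow> G z * bump x \<epsilon> z"
        by (intro AE_I2 tendsto_mult tendsto_const lim)
      show "AE z in lborel. norm (G z * bump (X n) \<epsilon> z) \<le> G z" for n
        using nonneg by (intro AE_I2) (simp add: abs_mult bump_nonneg bump_le_1 mult_left_le)
    qed measurable
    then show "(H \<circ> X) \<longlonglongrightarrow> H x" by (simp add: o_def)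
  qed
  \<comment> \<open>\<open>H\<close> vanishes outside this ball, so its maximum there is a global one.\<close>
  then have "continuous_on (cball 0 (r + 1)) H"
    by (rule continuous_on_subset) simp
  moreover have x0': "x0 \<in> cball 0 (r + 1)" using x0 by simp
  ultimately obtain a where a: "\<And>x. x \<in> cball 0 (r + 1) \<Longrightarrow> H x \<le> H a"
    using continuous_attains_sup[of "cball 0 (r + 1)" H] compact_cball by blast
  have Ha: "H x \<le> H a" for x
  proof (cases "x \<in> cball 0 (r + 1)")
    case False
    have "G z * bump x \<epsilon> z = 0" for z
    proof (cases "z \<in> ball x \<epsilon>")
      case True
      then have "norm z > r"
        using False \<epsilon> norm_triangle_ineq[of z "x - z"] by (simp add: dist_norm norm_minus_commute)
      then show ?thesis using supp by simp
    qed (simp add: bump_eq_0[OF \<epsilon>(1)])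
    then have "H x = 0" unfolding H_def by (simp only: Bochner_Integration.integral_zero)
    also have "0 \<le> H x0" unfolding H_def by (simp add: nonneg bump_nonneg)
    also have "H x0 \<le> H a" by (rule a[OF x0'])
    finally show ?thesis .
  qed (simp add: a)
  \<comment> \<open>At \<open>p\<close> the mollification loses at most a quarter of the maximum \<open>m\<close>, so at the maximum
    point of \<open>H\<close> some nearby value of \<open>G\<close> exceeds \<open>m / 2\<close>.\<close>
  have "3 / 4 * m * J = (\<integral>z. 3 / 4 * m * bump p \<epsilon> z \<partial>lborel)"
    by (simp add: J)
  also have "\<dots> \<le> H p"
    unfolding H_def
  proof (rule integral_mono[OF intb intGb])
    fix z
    show "3 / 4 * m * bump p \<epsilon> z \<le> G z * bump p \<epsilon> z"
    proof (cases "z \<in> ball p \<epsilon>")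
      case True
      then have "3 / 4 * m \<le> G z"
        using near[OF p(1), of z] \<epsilon>(1) by (simp add: m_def dist_commute)
      then show ?thesis by (intro mult_right_mono bump_nonneg)
    qed (simp add: bump_eq_0[OF \<epsilon>(1)])
  qed
  also have "\<dots> \<le> H a" by (rule Ha)
  finally have Ha_large: "3 / 4 * m * J \<le> H a" .
  have "\<exists>z\<in>ball a \<epsilon>. G z > m / 2"
  proof (rule ccontr)
    assume "\<not> (\<exists>z\<in>ball a \<epsilon>. G z > m / 2)"
    then have le: "G z \<le> m / 2" if "z \<in> ball a \<epsilon>" for z using that by force
    have "H a \<le> (\<integral>z. m / 2 * bump a \<epsilon> z \<partial>lborel)"
      unfolding H_def
    proof (rule integral_mono[OF intGb intb])
      fix z
      show "G z * bump a \<epsilon> z \<le> m / 2 * bump a \<epsilon> z"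
      proof (cases "z \<in> ball a \<epsilon>")
        case True
        show ?thesis by (rule mult_right_mono[OF le[OF True] bump_nonneg])
      qed (simp add: bump_eq_0[OF \<epsilon>(1)])
    qed
    then have "H a \<le> m / 2 * J" by (simp add: J)
    then have "m / 4 * J \<le> 0" using Ha_large by (simp add: algebra_simps)
    moreover have "m / 4 * J > 0" by (intro mult_pos_pos J(1)) (use m in simp)
    ultimately show False by linarith
  qed
  then obtain z0 where z0: "z0 \<in> ball a \<epsilon>" "G z0 > m / 2" by blast
  have "\<forall>z\<in>cball a \<epsilon>. G z > 0"
  proof
    fix z assume "z \<in> cball a \<epsilon>"
    then have "dist z z0 \<le> 2 * \<epsilon>"
      using z0(1) dist_triangle2[of z z0 a] by (simp add: dist_commute)
    moreover have "z0 \<in> cball 0 r" using z0(2) supp[of z0] m by fastforce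
    ultimately have "G z0 - m / 4 < G z" by (intro near)
    then show "G z > 0" using z0(2) m by simp
  qed
  moreover have "(\<integral>z. G z * laplacian (bump a \<epsilon>) z \<partial>lborel) \<le> 0"
  proof (rule LIMSEQ_le_const2)
    show "(\<lambda>n. \<Sum>b\<in>Basis. (\<integral>z. G z * second_diff (bump a \<epsilon>) (inverse (real (Suc n)) *\<^sub>R b) z \<partial>lborel)
            / (inverse (real (Suc n)))\<^sup>2)
      \<longlonglongrightarrow> (\<integral>z. G z * laplacian (bump a \<epsilon>) z \<partial>lborel)"
      by (rule integral_laplacian_tendsto(2)[OF G smooth_on_bump]) (rule bump_eq_0_cball[OF \<epsilon>(1)])
  next
    show "\<exists>N. \<forall>n\<ge>N. (\<Sum>b\<in>Basis. (\<integral>z. G z * second_diff (bump a \<epsilon>) (inverse (real (Suc n)) *\<^sub>R b) z \<partial>lborel)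
            / (inverse (real (Suc n)))\<^sup>2) \<le> 0"
    proof (intro exI[of _ 0] allI impI sum_nonpos divide_nonpos_nonneg zero_le_power2)
      fix n :: nat and b :: 'a
      define h where "h = inverse (real (Suc n)) *\<^sub>R b"
      have "(\<integral>z. G z * second_diff (bump a \<epsilon>) h z \<partial>lborel) =
        (\<integral>z. G z * bump (a - h) \<epsilon> z + G z * bump (a + h) \<epsilon> z - 2 * (G z * bump a \<epsilon> z) \<partial>lborel)"
        using bump_shift[of a h] bump_shift[of a "- h"]
        by (simp add: second_diff_def algebra_simps)
      also have "\<dots> = H (a - h) + H (a + h) - 2 * H a"
        using intGb by (simp add: H_def)
      also have "\<dots> \<le> 0" using Ha[of "a - h"] Ha[of "a + h"] by simp
      finally show "(\<integral>z. G z * second_diff (bump a \<epsilon>) (inverse (real (Suc n)) *\<^sub>R b) z \<partial>lborel) \<le> 0"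
        by (simp only: h_def)
    qed
  qed
  ultimately show ?thesis using \<epsilon>(1) by blast
qed

section \<open>The a priori estimate for the Dirichlet problem\<close>

lemma continuous_on_quadratic: "continuous_on S (\<lambda>z::'a::euclidean_space. d * ((norm (z - c))\<^sup>2 - e))"
  by (intro continuous_intros)

lemma second_diff_quadratic:
  fixes c :: "'a::real_inner"
  shows "second_diff (\<lambda>z. d * ((norm (z - c))\<^sup>2 - e)) h z = 2 * d * (norm h)\<^sup>2"
proof -
  have "second_diff (\<lambda>z. d * ((norm (z - c))\<^sup>2 - e)) h z = d * second_diff (\<lambda>z. (norm (z - c))\<^sup>2) h z"
    by (simp add: second_diff_def algebra_simps)
  then show ?thesis by (simp add: second_diff_norm_square)
qed

text \<open>The barrier argument for \<open>\<Delta> y = g \<ge> - K\<close>. If \<open>y\<close> exceeded the bound somewhere, then for some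
  \<open>K' > K\<close> the function \<open>y + Q\<close> with \<open>Q z = K' (\<bar>z - c\<bar>\<^sup>2 - R\<^sup>2) / (2 n)\<close> would be
  positive somewhere, although it is at most 0 on the boundary. Its positive part \<open>G\<close>, extended
  by 0, is continuous on the whole space, so there is a bump supported where \<open>G = y + Q\<close> whose
  Laplacian has integral at most 0 against \<open>G\<close>. But \<open>\<Delta> (y + Q) = g + K' \<ge> K' - K > 0\<close> in the
  sense of distributions, so that integral is positive.\<close>

lemma dirichlet_solution_le:
  fixes \<Omega> :: "'a::euclidean_space set"
  assumes \<Omega>: "open \<Omega>" "\<Omega> \<subseteq> ball c R" "R > 0"
    and y: "dirichlet_solution \<Omega> g y"
    and g: "continuous_on \<Omega> g" "\<And>x. x \<in> \<Omega> \<Longrightarrow> - K \<le> g x" and K: "K \<ge> 0"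
    and x: "x \<in> closure \<Omega>"
  shows "y x \<le> R\<^sup>2 / (2 * real DIM('a)) * K"
proof (rule ccontr)
  define n where "n = real DIM('a)"
  have n: "n > 0" by (simp add: n_def)
  define C where "C = R\<^sup>2 / (2 * n)"
  have C: "C > 0" using n \<Omega>(3) by (simp add: C_def)
  assume "\<not> y x \<le> R\<^sup>2 / (2 * real DIM('a)) * K"
  then have yx: "y x > C * K" by (simp add: C_def n_def)
  have y_cont: "continuous_on (closure \<Omega>) y" and y_distr: "distr_laplacian \<Omega> y g"
    and y_bd: "\<And>z. z \<in> frontier \<Omega> \<Longrightarrow> y z = 0"
    using y by (auto simp: dirichlet_solution_def)
  have "K < y x / C" using yx C by (simp add: field_simps)
  then obtain K' where K': "K < K'" "K' < y x / C"
    using dense by blast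
  have yx': "C * K' < y x" using K'(2) C by (simp add: field_simps)
  define d where "d = K' / (2 * n)"
  have d: "d > 0" "2 * d * n = K'" "d * R\<^sup>2 = C * K'"
    using K K'(1) n by (simp_all add: d_def C_def)
  define Q where "Q z = d * ((norm (z - c))\<^sup>2 - R\<^sup>2)" for z
  have Q_cont: "continuous_on S Q" for S
    unfolding Q_def by (rule continuous_on_quadratic)
  have closure_sub: "closure \<Omega> \<subseteq> cball c R"
    using closure_mono[OF \<Omega>(2)] \<Omega>(3) by simp
  have Q_le: "Q z \<le> 0" if "z \<in> closure \<Omega>" for z
  proof -
    have "norm (z - c) \<le> R" using closure_sub that by (auto simp: dist_norm norm_minus_commute)
    then have "(norm (z - c))\<^sup>2 \<le> R\<^sup>2" by (rule power_mono) simp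
    then show ?thesis using d(1) by (simp add: Q_def mult_nonneg_nonpos)
  qed
  have Q_ge: "- (C * K') \<le> Q z" for z
    using d(1) by (simp add: Q_def right_diff_distrib d(3))
  define G where "G z = (if z \<in> closure \<Omega> then max 0 (y z + Q z) else 0)" for z
  have G_out: "G z = 0" if "z \<notin> \<Omega>" for z
  proof (cases "z \<in> closure \<Omega>")
    case True
    then have "z \<in> frontier \<Omega>" using that \<Omega>(1) by (simp add: frontier_def interior_open)
    then show ?thesis using Q_le[OF True] y_bd by (simp add: G_def)
  qed (simp add: G_def)
  \<comment> \<open>The two closed pieces overlap in the frontier, where both formulas give 0.\<close>
  have "continuous_on (closure \<Omega> \<union> - \<Omega>) G"
  proof (rule continuous_on_closed_Un)
    have "continuous_on (closure \<Omega>) (\<lambda>z. max 0 (y z + Q z))"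
      by (intro continuous_on_max continuous_on_const continuous_on_add y_cont Q_cont)
    then show "continuous_on (closure \<Omega>) G"
      by (rule continuous_on_eq) (simp add: G_def)
    show "continuous_on (- \<Omega>) G"
      by (rule continuous_on_eq[OF continuous_on_const[of _ 0]]) (simp add: G_out)
    show "closed (- \<Omega>)" using \<Omega>(1) by (rule closed_Compl)
  qed simp
  moreover have "closure \<Omega> \<union> - \<Omega> = UNIV" using closure_subset[of \<Omega>] by blast
  ultimately have G_cont: "continuous_on UNIV G" by simp
  have G_supp: "G z = 0" if "z \<notin> cball 0 (norm c + R)" for z
  proof (rule G_out)
    show "z \<notin> \<Omega>"
    proof
      assume "z \<in> \<Omega>"
      then have "norm (z - c) < R" using \<Omega>(2) by (auto simp: dist_norm norm_minus_commute)
      then show False using that norm_triangle_ineq2[of z c] by simp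
    qed
  qed
  have "G x > 0"
    using yx' Q_ge[of x] x by (simp add: G_def)
  moreover have "G z \<ge> 0" for z by (simp add: G_def)
  ultimately obtain a \<epsilon> where \<epsilon>: "\<epsilon> > 0" and pos: "\<And>z. z \<in> cball a \<epsilon> \<Longrightarrow> G z > 0"
    and neg: "(\<integral>z. G z * laplacian (bump a \<epsilon>) z \<partial>lborel) \<le> 0"
    using exists_bump_nonpos_laplacian_integral[OF G_cont G_supp] by blast
  let ?\<psi> = "bump a \<epsilon>"
  have sub: "cball a \<epsilon> \<subseteq> \<Omega>"
  proof
    fix z assume "z \<in> cball a \<epsilon>"
    from pos[OF this] show "z \<in> \<Omega>" using G_out[of z] by fastforce
  qed
  have G_eq: "G z = y z + Q z" if "z \<in> cball a \<epsilon>" for z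
    using pos[OF that] by (simp add: G_def split: if_splits)
  have lap0: "laplacian ?\<psi> z = 0" if "z \<notin> cball a \<epsilon>" for z
  proof (rule laplacian_eq_0_outside_support)
    show "z \<notin> closure {z. ?\<psi> z \<noteq> 0}"
      using that \<epsilon> by (simp only: bump_neq_0_iff[OF \<epsilon>] Collect_mem_eq closure_ball) simp
  qed
  have bump0: "\<And>z. z \<notin> cball 0 (norm a + \<epsilon>) \<Longrightarrow> ?\<psi> z = 0"
    by (rule bump_eq_0_cball[OF \<epsilon>])
  have "(LINT z:\<Omega>|lborel. y z * laplacian ?\<psi> z) =
      (\<integral>z. G z * laplacian ?\<psi> z - Q z * laplacian ?\<psi> z \<partial>lborel)"
    unfolding set_lebesgue_integral_def
  proof (rule Bochner_Integration.integral_cong[OF refl])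
    fix z
    show "indicator \<Omega> z *\<^sub>R (y z * laplacian ?\<psi> z) = G z * laplacian ?\<psi> z - Q z * laplacian ?\<psi> z"
      using sub G_eq[of z] lap0[of z]
      by (cases "z \<in> cball a \<epsilon>") (auto simp: algebra_simps subset_iff)
  qed
  also have "\<dots> = (\<integral>z. G z * laplacian ?\<psi> z \<partial>lborel) - (\<integral>z. Q z * laplacian ?\<psi> z \<partial>lborel)"
    by (intro Bochner_Integration.integral_diff
        integral_laplacian_tendsto(1)[OF G_cont smooth_on_bump bump0]
        integral_laplacian_tendsto(1)[OF Q_cont smooth_on_bump bump0])
  also have "(\<integral>z. Q z * laplacian ?\<psi> z \<partial>lborel) = 2 * d * n * (\<integral>z. ?\<psi> z \<partial>lborel)"
    unfolding n_def
  proof (rule integral_quadratic_laplacian[OF Q_cont smooth_on_bump bump0])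
    show "second_diff Q h z = 2 * d * (norm h)\<^sup>2" for h z
      unfolding Q_def by (rule second_diff_quadratic)
  qed
  finally have upper: "(LINT z:\<Omega>|lborel. y z * laplacian ?\<psi> z) \<le> - (K' * (\<integral>z. ?\<psi> z \<partial>lborel))"
    using neg by (simp add: d(2))
  have int1: "integrable lborel (\<lambda>z. indicator \<Omega> z *\<^sub>R (g z * ?\<psi> z))"
  proof -
    have "integrable lborel (\<lambda>z. indicator (cball a \<epsilon>) z *\<^sub>R (g z * ?\<psi> z))"
      by (intro borel_integrable_compact continuous_on_mult continuous_on_subset[OF g(1) sub]
          continuous_on_subset[OF continuous_on_bump] compact_cball subset_UNIV)
    moreover have "indicator (cball a \<epsilon>) z *\<^sub>R (g z * ?\<psi> z) = indicator \<Omega> z *\<^sub>R (g z * ?\<psi> z)" for z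
      using sub bump_eq_0[OF \<epsilon>, of z a] by (cases "z \<in> cball a \<epsilon>") (auto simp: subset_iff)
    ultimately show ?thesis by (simp only:)
  qed
  have int2: "integrable lborel (\<lambda>z. - K * ?\<psi> z)"
    by (rule integrable_mult_bump[OF continuous_on_const \<epsilon>])
  have "(\<integral>z. - K * ?\<psi> z \<partial>lborel) \<le> (LINT z:\<Omega>|lborel. g z * ?\<psi> z)"
    unfolding set_lebesgue_integral_def
  proof (rule integral_mono[OF int2 int1])
    fix z
    show "- K * ?\<psi> z \<le> indicator \<Omega> z *\<^sub>R (g z * ?\<psi> z)"
    proof (cases "z \<in> \<Omega>")
      case True
      then show ?thesis using mult_right_mono[OF g(2)[OF True] bump_nonneg[of a \<epsilon> z]] by simp
    next
      case False
      then have "z \<notin> ball a \<epsilon>" using sub ball_subset_cball by blast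
      then have "?\<psi> z = 0" by (rule bump_eq_0[OF \<epsilon>])
      then show ?thesis by simp
    qed
  qed
  also have "\<dots> = (LINT z:\<Omega>|lborel. y z * laplacian ?\<psi> z)"
    using y_distr test_function_bump[OF \<epsilon> sub] by (simp add: distr_laplacian_def)
  finally have "(K' - K) * (\<integral>z. ?\<psi> z \<partial>lborel) \<le> 0"
    using upper by (simp add: algebra_simps)
  then show False
    using mult_pos_pos[OF _ integral_bump_pos[OF \<epsilon>, of a], of "K' - K"] K'(1) by simp
qed

lemma set_integrable_mult_closure:
  fixes \<Omega> :: "'a::euclidean_space set"
  assumes "open \<Omega>" "bounded \<Omega>" "continuous_on (closure \<Omega>) y" "continuous_on UNIV p"
  shows "set_integrable lborel \<Omega> (\<lambda>z. y z * p z :: real)"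
proof (rule set_integrable_subset)
  show "set_integrable lborel (closure \<Omega>) (\<lambda>z. y z * p z)"
    unfolding set_integrable_def
    by (intro borel_integrable_compact continuous_on_mult assms(3)
        continuous_on_subset[OF assms(4)]) (use assms(2) in auto)
qed (use assms(1) closure_subset in auto)

lemma dirichlet_solution_diff:
  assumes \<Omega>: "open \<Omega>" "bounded \<Omega>"
    and y1: "dirichlet_solution \<Omega> g1 y1" and y2: "dirichlet_solution \<Omega> g2 y2"
    and g: "continuous_on (closure \<Omega>) g1" "continuous_on (closure \<Omega>) g2"
  shows "dirichlet_solution \<Omega> (\<lambda>x. g1 x - g2 x) (\<lambda>x. y1 x - y2 x)"
proof -
  have "(LINT x:\<Omega>|lborel. (y1 x - y2 x) * laplacian \<psi> x) = (LINT x:\<Omega>|lborel. (g1 x - g2 x) * \<psi> x)"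
    if \<psi>: "test_function \<Omega> \<psi>" for \<psi>
  proof -
    have cont: "continuous_on UNIV \<psi>" "continuous_on UNIV (laplacian \<psi>)"
      using \<psi> by (auto simp: test_function_def intro: smooth_on_continuous_on continuous_on_laplacian)
    have y: "continuous_on (closure \<Omega>) y1" "continuous_on (closure \<Omega>) y2"
      using y1 y2 by (auto simp: dirichlet_solution_def)
    note int = set_integrable_mult_closure[OF \<Omega>]
    have "(LINT x:\<Omega>|lborel. (y1 x - y2 x) * laplacian \<psi> x) =
        (LINT x:\<Omega>|lborel. y1 x * laplacian \<psi> x) - (LINT x:\<Omega>|lborel. y2 x * laplacian \<psi> x)"
      unfolding left_diff_distrib by (intro set_integral_diff(2) int y cont)
    also have "\<dots> = (LINT x:\<Omega>|lborel. g1 x * \<psi> x) - (LINT x:\<Omega>|lborel. g2 x * \<psi> x)"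
      using y1 y2 \<psi> by (simp add: dirichlet_solution_def distr_laplacian_def)
    also have "\<dots> = (LINT x:\<Omega>|lborel. (g1 x - g2 x) * \<psi> x)"
      unfolding left_diff_distrib by (intro set_integral_diff(2)[symmetric] int g cont)
    finally show ?thesis .
  qed
  then show ?thesis
    using y1 y2 by (auto simp: dirichlet_solution_def distr_laplacian_def intro: continuous_on_diff)
qed

lemma dirichlet_solution_dist_le:
  fixes \<Omega> :: "'a::euclidean_space set"
  assumes \<Omega>: "open \<Omega>" "bounded \<Omega>" "\<Omega> \<subseteq> ball c R" "R > 0"
    and y1: "dirichlet_solution \<Omega> g1 y1" and y2: "dirichlet_solution \<Omega> g2 y2"
    and g: "continuous_on (closure \<Omega>) g1" "continuous_on (closure \<Omega>) g2"
    and K: "\<And>x. x \<in> \<Omega> \<Longrightarrow> \<bar>g1 x - g2 x\<bar> \<le> K" "K \<ge> 0"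
    and x: "x \<in> closure \<Omega>"
  shows "\<bar>y1 x - y2 x\<bar> \<le> R\<^sup>2 / (2 * real DIM('a)) * K"
proof -
  have gc: "continuous_on \<Omega> g1" "continuous_on \<Omega> g2"
    using g closure_subset continuous_on_subset by blast+
  have "y1 x - y2 x \<le> R\<^sup>2 / (2 * real DIM('a)) * K"
  proof (rule dirichlet_solution_le[OF \<Omega>(1,3,4) dirichlet_solution_diff[OF \<Omega>(1,2) y1 y2 g]
        continuous_on_diff[OF gc] _ K(2) x])
    show "- K \<le> g1 z - g2 z" if "z \<in> \<Omega>" for z using K(1)[OF that] by linarith
  qed
  moreover have "y2 x - y1 x \<le> R\<^sup>2 / (2 * real DIM('a)) * K"
  proof (rule dirichlet_solution_le[OF \<Omega>(1,3,4) dirichlet_solution_diff[OF \<Omega>(1,2) y2 y1 g(2,1)]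
        continuous_on_diff[OF gc(2,1)] _ K(2) x])
    show "- K \<le> g2 z - g1 z" if "z \<in> \<Omega>" for z using K(1)[OF that] by linarith
  qed
  ultimately show ?thesis by linarith
qed

lemma dirichlet_solution_0: "dirichlet_solution \<Omega> (\<lambda>_. 0) (\<lambda>_. 0)"
  by (simp add: dirichlet_solution_def distr_laplacian_def)

lemma max_norm_ge:
  assumes "bounded \<Omega>" "continuous_on (closure \<Omega>) y" "x \<in> closure \<Omega>"
  shows "\<bar>y x\<bar> \<le> max_norm (closure \<Omega>) y"
proof -
  have "compact ((\<lambda>x. \<bar>y x\<bar>) ` closure \<Omega>)"
    by (intro compact_continuous_image continuous_on_rabs assms) (simp add: assms)
  then have "bdd_above ((\<lambda>x. \<bar>y x\<bar>) ` closure \<Omega>)"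
    by (intro bounded_imp_bdd_above compact_imp_bounded)
  then show ?thesis unfolding max_norm_def using assms(3) by (intro cSUP_upper)
qed

lemma max_norm_le:
  "S \<noteq> {} \<Longrightarrow> (\<And>x. x \<in> S \<Longrightarrow> \<bar>y x\<bar> \<le> B) \<Longrightarrow> max_norm S y \<le> B"
  unfolding max_norm_def by (rule cSUP_least)

section \<open>The iteration as a contraction\<close>

text \<open>Three applications of the estimate for one Dirichlet problem, each gaining a factor \<open>C\<close>.\<close>

lemma iterated_dirichlet_dist_le:
  fixes \<Omega> :: "'a::euclidean_space set"
  assumes \<Omega>: "open \<Omega>" "bounded \<Omega>" "\<Omega> \<subseteq> ball c R" "R > 0"
    and C_def: "C = R\<^sup>2 / (2 * real DIM('a))"
    and y1: "dirichlet_solution \<Omega> g1 w1" "dirichlet_solution \<Omega> w1 v1" "dirichlet_solution \<Omega> v1 u1"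
    and y2: "dirichlet_solution \<Omega> g2 w2" "dirichlet_solution \<Omega> w2 v2" "dirichlet_solution \<Omega> v2 u2"
    and g: "continuous_on (closure \<Omega>) g1" "continuous_on (closure \<Omega>) g2"
    and K: "\<And>x. x \<in> \<Omega> \<Longrightarrow> \<bar>g1 x - g2 x\<bar> \<le> K" "K \<ge> 0"
    and x: "x \<in> closure \<Omega>"
  shows "\<bar>w1 x - w2 x\<bar> \<le> C * K" "\<bar>v1 x - v2 x\<bar> \<le> C\<^sup>2 * K" "\<bar>u1 x - u2 x\<bar> \<le> C ^ 3 * K"
proof -
  have C: "C \<ge> 0" by (simp add: C_def)
  have cont: "continuous_on (closure \<Omega>) w1" "continuous_on (closure \<Omega>) w2"
    "continuous_on (closure \<Omega>) v1" "continuous_on (closure \<Omega>) v2"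
    using y1 y2 by (auto simp: dirichlet_solution_def)
  note step = dirichlet_solution_dist_le[OF \<Omega>, folded C_def]
  have w: "\<bar>w1 x - w2 x\<bar> \<le> C * K" if "x \<in> closure \<Omega>" for x
    by (rule step[OF y1(1) y2(1) g K that])
  have v: "\<bar>v1 x - v2 x\<bar> \<le> C * (C * K)" if "x \<in> closure \<Omega>" for x
  proof (rule step[OF y1(2) y2(2) cont(1,2) _ _ that])
    show "\<bar>w1 z - w2 z\<bar> \<le> C * K" if "z \<in> \<Omega>" for z
      using w that closure_subset by blast
  qed (use C K(2) in simp)
  have u: "\<bar>u1 x - u2 x\<bar> \<le> C * (C * (C * K))"
  proof (rule step[OF y1(3) y2(3) cont(3,4) _ _ x])
    show "\<bar>v1 z - v2 z\<bar> \<le> C * (C * K)" if "z \<in> \<Omega>" for z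
      using v that closure_subset by blast
  qed (use C K(2) in simp)
  show "\<bar>w1 x - w2 x\<bar> \<le> C * K" "\<bar>v1 x - v2 x\<bar> \<le> C\<^sup>2 * K" "\<bar>u1 x - u2 x\<bar> \<le> C ^ 3 * K"
    using w[OF x] v[OF x] u by (simp_all add: power2_eq_square power3_eq_cube mult.assoc)
qed

theorem theorem3p1:
  fixes \<Omega> :: "'a::euclidean_space set"
    and c :: 'a
    and R C M L1 L2 L3 q :: real
    and f :: "'a \<times> real \<times> real \<times> real \<Rightarrow> real"
    and u v w :: "'a \<Rightarrow> real"
    and \<phi> uk vk wk :: "nat \<Rightarrow> 'a \<Rightarrow> real"
  assumes dim: "DIM('a) \<ge> 2"
    and domain: "open \<Omega>" "connected \<Omega>" "\<Omega> \<noteq> {}" "bounded \<Omega>" "smooth_boundary \<Omega>"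
    and radius: "R > 0" "\<Omega> \<subseteq> ball c R"
    and C_eq: "C = R\<^sup>2 / (2 * real DIM('a))"
    and f_cont: "continuous_on (closure \<Omega> \<times> UNIV) f"
    and nonneg: "M \<ge> 0" "L1 \<ge> 0" "L2 \<ge> 0" "L3 \<ge> 0"
    and f_bound: "\<forall>z \<in> D_set \<Omega> C M. \<bar>f z\<bar> \<le> M"
    and f_lipschitz: "\<forall>x u1 v1 w1 u2 v2 w2.
          (x, u1, v1, w1) \<in> D_set \<Omega> C M \<longrightarrow> (x, u2, v2, w2) \<in> D_set \<Omega> C M \<longrightarrow>
          \<bar>f (x, u2, v2, w2) - f (x, u1, v1, w1)\<bar>
            \<le> L1 * \<bar>u2 - u1\<bar> + L2 * \<bar>v2 - v1\<bar> + L3 * \<bar>w2 - w1\<bar>"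
    and q_eq: "q = (C\<^sup>2 * L1 + C * L2 + L3) * C"
    and q_less: "q < 1"
    and solution: "bvp_solution \<Omega> f u v w"
    and solution_bounds:
          "max_norm (closure \<Omega>) u \<le> C ^ 3 * M"
          "max_norm (closure \<Omega>) v \<le> C\<^sup>2 * M"
          "max_norm (closure \<Omega>) w \<le> C * M"
    and phi_0: "continuous_on (closure \<Omega>) (\<phi> 0)" "max_norm (closure \<Omega>) (\<phi> 0) \<le> M"
    and iter_w: "\<forall>k. dirichlet_solution \<Omega> (\<phi> k) (wk k)"
    and iter_v: "\<forall>k. dirichlet_solution \<Omega> (wk k) (vk k)"
    and iter_u: "\<forall>k. dirichlet_solution \<Omega> (vk k) (uk k)"
    and phi_Suc: "\<forall>k. \<forall>x\<in>closure \<Omega>. \<phi> (Suc k) x = f (x, uk k x, vk k x, wk k x)"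
  shows "uniform_limit (closure \<Omega>) uk u sequentially \<and>
    (\<forall>k. max_norm (closure \<Omega>) (\<lambda>x. uk k x - u x)
      \<le> C ^ 3 * q ^ k / (1 - q) * max_norm (closure \<Omega>) (\<lambda>x. \<phi> 1 x - \<phi> 0 x))"
proof -
  define F where "F x = f (x, u x, v x, w x)" for x
  have C: "C \<ge> 0" by (simp add: C_eq)
  have q: "q \<ge> 0" using C nonneg by (simp add: q_eq)
  have sub: "x \<in> closure \<Omega>" if "x \<in> \<Omega>" for x
    using that closure_subset by blast
  have sol: "dirichlet_solution \<Omega> F w" "dirichlet_solution \<Omega> w v" "dirichlet_solution \<Omega> v u"
    using solution by (auto simp: bvp_solution_def F_def[abs_def])
  have it: "dirichlet_solution \<Omega> (\<phi> k) (wk k)" "dirichlet_solution \<Omega> (wk k) (vk k)"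
    "dirichlet_solution \<Omega> (vk k) (uk k)" for k
    using iter_w iter_v iter_u by auto
  have cont: "continuous_on (closure \<Omega>) y" if "dirichlet_solution \<Omega> g y" for g y
    using that by (simp add: dirichlet_solution_def)
  have f_comp: "continuous_on (closure \<Omega>) (\<lambda>x. f (x, y1 x, y2 x, y3 x))"
    if "continuous_on (closure \<Omega>) y1" "continuous_on (closure \<Omega>) y2"
      "continuous_on (closure \<Omega>) y3" for y1 y2 y3
    by (rule continuous_on_compose2[OF f_cont])
       (auto intro!: continuous_on_Pair continuous_on_id that)
  have F_cont: "continuous_on (closure \<Omega>) F"
    unfolding F_def using sol by (intro f_comp cont)
  have \<phi>_cont: "continuous_on (closure \<Omega>) (\<phi> k)" for k
  proof (cases k)
    case 0
    then show ?thesis using phi_0(1) by simp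
  next
    case (Suc j)
    have "continuous_on (closure \<Omega>) (\<lambda>x. f (x, uk j x, vk j x, wk j x))"
      using it[of j] by (intro f_comp cont)
    then show ?thesis
      unfolding Suc by (rule continuous_on_eq) (simp add: phi_Suc)
  qed
  have D: "(x, u x, v x, w x) \<in> D_set \<Omega> C M" if "x \<in> \<Omega>" for x
    using max_norm_ge[OF domain(4) cont[OF sol(1)] sub[OF that]] solution_bounds
      max_norm_ge[OF domain(4) cont[OF sol(2)] sub[OF that]]
      max_norm_ge[OF domain(4) cont[OF sol(3)] sub[OF that]] that
    by (simp add: D_set_def)
  \<comment> \<open>The zero functions solve the problem with zero right-hand side, so comparing with them bounds
    the iterates themselves.\<close>
  have Dk: "(x, uk k x, vk k x, wk k x) \<in> D_set \<Omega> C M"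
    if "\<forall>x\<in>\<Omega>. \<bar>\<phi> k x\<bar> \<le> M" "x \<in> \<Omega>" for k x
    using iterated_dirichlet_dist_le[OF domain(1,4) radius(2,1) C_eq it
        dirichlet_solution_0 dirichlet_solution_0 dirichlet_solution_0 \<phi>_cont
        continuous_on_const _ nonneg(1) sub[OF that(2)]] that
    by (simp add: D_set_def)
  have \<phi>_bound: "\<forall>x\<in>\<Omega>. \<bar>\<phi> k x\<bar> \<le> M" for k
  proof (induction k)
    case 0
    then show ?case
      using max_norm_ge[OF domain(4) phi_0(1) sub] phi_0(2) by (auto intro: order_trans)
  next
    case (Suc k)
    then show ?case using f_bound Dk sub phi_Suc by auto
  qed
  have F_bound: "\<bar>F x\<bar> \<le> M" if "x \<in> \<Omega>" for x
    using f_bound D[OF that] by (simp add: F_def)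
  note dist = iterated_dirichlet_dist_le[OF domain(1,4) radius(2,1) C_eq it sol \<phi>_cont F_cont]
  have contract: "\<bar>\<phi> (Suc k) x - F x\<bar> \<le> q * E"
    if E: "\<And>x. x \<in> \<Omega> \<Longrightarrow> \<bar>\<phi> k x - F x\<bar> \<le> E" "E \<ge> 0" and x: "x \<in> \<Omega>" for k E x
  proof -
    have "\<bar>\<phi> (Suc k) x - F x\<bar> \<le> L1 * \<bar>uk k x - u x\<bar> + L2 * \<bar>vk k x - v x\<bar> + L3 * \<bar>wk k x - w x\<bar>"
      using f_lipschitz D[OF x] Dk[OF \<phi>_bound x] phi_Suc sub[OF x] by (simp add: F_def)
    also have "\<dots> \<le> L1 * (C ^ 3 * E) + L2 * (C\<^sup>2 * E) + L3 * (C * E)"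
      using dist[OF E sub[OF x]] nonneg by (intro add_mono mult_left_mono)
    also have "\<dots> = q * E"
      by (simp add: q_eq power2_eq_square power3_eq_cube algebra_simps)
    finally show ?thesis .
  qed
  define d where "d = max_norm (closure \<Omega>) (\<lambda>x. \<phi> 1 x - \<phi> 0 x)"
  have d: "\<bar>\<phi> 1 x - \<phi> 0 x\<bar> \<le> d" if "x \<in> closure \<Omega>" for x
    unfolding d_def
    by (rule max_norm_ge[OF domain(4) _ that]) (intro continuous_on_diff \<phi>_cont)
  \<comment> \<open>The supremum is taken over \<open>\<Omega>\<close> only, since the Lipschitz condition is given there. It
    satisfies \<open>E \<le> d + q * E\<close>, which can be solved for \<open>E\<close> because \<open>q < 1\<close>.\<close>
  define E where "E = (SUP x\<in>\<Omega>. \<bar>\<phi> 0 x - F x\<bar>)"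
  have "\<bar>\<phi> 0 x - F x\<bar> \<le> 2 * M" if "x \<in> \<Omega>" for x
    using \<phi>_bound[of 0] F_bound[OF that] that by fastforce
  then have bdd: "bdd_above ((\<lambda>x. \<bar>\<phi> 0 x - F x\<bar>) ` \<Omega>)"
    by (intro bdd_aboveI2)
  have E: "\<bar>\<phi> 0 x - F x\<bar> \<le> E" if "x \<in> \<Omega>" for x
    unfolding E_def by (rule cSUP_upper[OF that bdd])
  obtain x0 where x0: "x0 \<in> \<Omega>" using domain(3) by blast
  have E0: "E \<ge> 0" using E[OF x0] by linarith
  have "\<bar>\<phi> 0 x - F x\<bar> \<le> d + q * E" if x: "x \<in> \<Omega>" for x
    using d[OF sub[OF x]] contract[OF E E0 x] by simp
  then have "(SUP x\<in>\<Omega>. \<bar>\<phi> 0 x - F x\<bar>) \<le> d + q * E"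
    by (intro cSUP_least domain(3))
  then have "E \<le> d + q * E" by (simp only: E_def)
  then have E_le: "E \<le> d / (1 - q)"
    using q_less by (simp add: field_simps)
  define B where "B = d / (1 - q)"
  have B0: "B \<ge> 0" using E0 E_le by (simp add: B_def)
  have geom: "\<bar>\<phi> k x - F x\<bar> \<le> q ^ k * B" if "x \<in> \<Omega>" for k x
    using that
  proof (induction k arbitrary: x)
    case 0
    then show ?case using E[OF 0] E_le by (simp add: B_def)
  next
    case (Suc k)
    then show ?case using contract[of k "q ^ k * B" x] q B0 by (simp add: mult.assoc)
  qed
  have u_le: "\<bar>uk k x - u x\<bar> \<le> C ^ 3 * (q ^ k * B)" if "x \<in> closure \<Omega>" for k x
    using dist(3)[OF geom _ that] q B0 by simp
  have "uniform_limit (closure \<Omega>) uk u sequentially"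
  proof (rule uniform_limitI)
    fix e :: real assume e: "e > 0"
    have "(\<lambda>k. C ^ 3 * (q ^ k * B)) \<longlonglongrightarrow> C ^ 3 * (0 * B)"
      using q q_less by (intro tendsto_intros LIMSEQ_realpow_zero)
    then have "\<forall>\<^sub>F k in sequentially. C ^ 3 * (q ^ k * B) < e"
      using e by (intro order_tendstoD) auto
    then show "\<forall>\<^sub>F k in sequentially. \<forall>x\<in>closure \<Omega>. dist (uk k x) (u x) < e"
      by (rule eventually_mono) (auto simp: dist_real_def intro: order_le_less_trans[OF u_le])
  qed
  moreover have "max_norm (closure \<Omega>) (\<lambda>x. uk k x - u x) \<le> C ^ 3 * q ^ k / (1 - q) * d" for k
  proof (rule max_norm_le)
    show "\<bar>uk k x - u x\<bar> \<le> C ^ 3 * q ^ k / (1 - q) * d" if "x \<in> closure \<Omega>" for x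
      using u_le[OF that, of k] by (simp add: B_def)
  qed (use domain(3) in simp)
  ultimately show ?thesis by (simp add: d_def)
qed

end
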